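(* Let $N>2t^2+t$. In the system model below, Algorithm B solves order-preserving renaming with target namespace of size $N^2$ in $2$ communication steps: every correct process outputs an integer in $[1,\dots,N^2]$, and for any two correct processes with original identifiers $id<id'$, the new name of the process with $id$ is strictly smaller than that of the process with $id'$.
   Context: System model: $N$ processes (with $N$ known to all) in a fully connected synchronous message-passing network. Computation proceeds in synchronous communication steps; messages sent in a step are received in that step. Each process's links are labeled $1,\dots,N$ (link $N$ a self-loop); a receiver knows the label of the link on which a message arrived, but not the sender's identifier. Channels are reliable. Each correct process has a unique original identifier (an integer in $[1,N_{max}]$), initially known only to itself. Up to $t$ processes are Byzantine and may behave arbitrarily. "Broadcast" means send to all $N$ links. Algorithm B (each correct process): Step 1: broadcast $\langle ID, my\_id\rangle$; for each $\langle ID,id\rangle$ received on link $lnk$ set linkid$[lnk]:=id$ and add $id$ to the set timely (linkid$[lnk]=\perp$ for links with no ID message). Step 2: broadcast $\langle MULTIECHO,\text{timely}\rangle$; for each $\langle MULTIECHO, ids\rangle$ received on link $lnk$, if linkid$[lnk]\ne\perp$, $|ids|\le N$ and $|\text{timely}\cap ids|\ge N-t$, then for each $id\in ids$ add $id$ to accepted and increment counter$[id]$ (initially $0$). Then, for each $id\in$ accepted, newid$[id]:=\sum_{id''\in \text{accepted},\, id''\le id}\min(\text{counter}[id''],N-t)$; output newid$[my\_id]$. *)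

theory Defs
  imports Main
begin

text \<open>
  A Byzantine synchronous system. The elements of \<open>procs\<close> are names used only to speak about the
  system; no process sees them. A process \<open>p\<close> sees its original identifier \<open>orig p\<close> and its own
  link labels, where \<open>link p l\<close> is the process at the other end of the link that \<open>p\<close> labels \<open>l\<close>.
  Labellings of different processes are unrelated. Nothing is assumed about the identifiers
  of faulty processes.
\<close>

locale byzantine_system =
  fixes N t :: nat
    and Nmax :: int
    and procs correct :: "'p set"
    and link :: "'p \<Rightarrow> nat \<Rightarrow> 'p"
    and orig :: "'p \<Rightarrow> int"
  assumes finite_procs: "finite procs"
    and card_procs: "card procs = N"
    and correct_subset: "correct \<subseteq> procs"
    and faulty_bound: "card (procs - correct) \<le> t"
    and link_bij: "\<And>p. p \<in> procs \<Longrightarrow> bij_betw (link p) {1..N} procs"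
    and link_self: "\<And>p. p \<in> procs \<Longrightarrow> link p N = p"
    and orig_range: "\<And>p. p \<in> correct \<Longrightarrow> orig p \<in> {1..Nmax}"
    and orig_unique: "inj_on orig correct"

text \<open>
  A step-based protocol whose messages are always broadcast. Steps are numbered from 1.
  An inbox maps each link label to the message that arrived on that link, if any.
\<close>

record ('s, 'm, 'o) protocol =
  init :: "int \<Rightarrow> 's"
  bcast :: "nat \<Rightarrow> 's \<Rightarrow> 'm option"
  trans :: "nat \<Rightarrow> 's \<Rightarrow> (nat \<Rightarrow> 'm option) \<Rightarrow> 's"
  outp :: "'s \<Rightarrow> 'o option"

text \<open>
  \<open>sent k q p\<close> is the message that \<open>q\<close> sends in step \<open>k\<close> on its link to \<open>p\<close>; in each step a link
  carries at most one message in each direction.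
\<close>

definition inbox ::
  "nat \<Rightarrow> ('p \<Rightarrow> nat \<Rightarrow> 'p) \<Rightarrow> (nat \<Rightarrow> 'p \<Rightarrow> 'p \<Rightarrow> 'm option) \<Rightarrow> nat \<Rightarrow> 'p \<Rightarrow> nat \<Rightarrow> 'm option" where
  "inbox N link sent k p l = (if l \<in> {1..N} then sent k (link p l) p else None)"

text \<open>
  \<open>st p k\<close> is the local state of \<open>p\<close> after \<open>k\<close> steps. Only correct processes are constrained:
  the values \<open>sent k q p\<close> for faulty \<open>q\<close> are arbitrary and may differ between receivers.
\<close>

definition execution ::
  "('s, 'm, 'o) protocol \<Rightarrow> nat \<Rightarrow> 'p set \<Rightarrow> 'p set \<Rightarrow> ('p \<Rightarrow> nat \<Rightarrow> 'p) \<Rightarrow> ('p \<Rightarrow> int) \<Rightarrow>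
   (nat \<Rightarrow> 'p \<Rightarrow> 'p \<Rightarrow> 'm option) \<Rightarrow> ('p \<Rightarrow> nat \<Rightarrow> 's) \<Rightarrow> bool" where
  "execution P N procs correct link orig sent st \<longleftrightarrow>
     (\<forall>p\<in>correct.
        st p 0 = init P (orig p) \<and>
        (\<forall>k. \<forall>q\<in>procs. sent (Suc k) p q = bcast P (Suc k) (st p k)) \<and>
        (\<forall>k. st p (Suc k) = trans P (Suc k) (st p k) (inbox N link sent (Suc k) p)))"

text \<open>\<open>M\<close> is the size of the target namespace; \<open>out p\<close> is what \<open>p\<close> has output, if anything.\<close>

definition order_preserving_renaming ::
  "nat \<Rightarrow> 'p set \<Rightarrow> ('p \<Rightarrow> int) \<Rightarrow> ('p \<Rightarrow> nat option) \<Rightarrow> bool" where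
  "order_preserving_renaming M correct orig out \<longleftrightarrow>
     (\<exists>new. (\<forall>p\<in>correct. out p = Some (new p) \<and> new p \<in> {1..M}) \<and>
            (\<forall>p\<in>correct. \<forall>q\<in>correct. orig p < orig q \<longrightarrow> new p < new q))"

datatype msg = ID int | MULTIECHO "int set"

record lstate =
  my_id :: int
  linkid :: "nat \<Rightarrow> int option"
  timely :: "int set"
  accepted :: "int set"
  counter :: "int \<Rightarrow> nat"
  newid :: "int \<Rightarrow> nat option"

definition initB :: "int \<Rightarrow> lstate" where
  "initB i = \<lparr>my_id = i, linkid = (\<lambda>_. None), timely = {}, accepted = {},
              counter = (\<lambda>_. 0), newid = (\<lambda>_. None)\<rparr>"

definition bcastB :: "nat \<Rightarrow> lstate \<Rightarrow> msg option" where
  "bcastB k s = (if k = 1 then Some (ID (my_id s))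
                 else if k = 2 then Some (MULTIECHO (timely s))
                 else None)"

definition step1 :: "lstate \<Rightarrow> (nat \<Rightarrow> msg option) \<Rightarrow> lstate" where
  "step1 s inb = s\<lparr>
     linkid := (\<lambda>l. case inb l of Some (ID i) \<Rightarrow> Some i | _ \<Rightarrow> None),
     timely := timely s \<union> {i. \<exists>l. inb l = Some (ID i)}\<rparr>"

text \<open>
  The explicit finiteness condition is part of \<open>|ids| \<le> N\<close>: \<open>card\<close> is 0 on infinite sets, and a
  faulty process may send any set.
\<close>

definition valid_echo :: "nat \<Rightarrow> nat \<Rightarrow> lstate \<Rightarrow> nat \<Rightarrow> int set \<Rightarrow> bool" where
  "valid_echo N t s l ids \<longleftrightarrow>
     linkid s l \<noteq> None \<and> finite ids \<and> card ids \<le> N \<and> card (timely s \<inter> ids) \<ge> N - t"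

definition collect_echoes ::
  "nat \<Rightarrow> nat \<Rightarrow> lstate \<Rightarrow> (nat \<Rightarrow> msg option) \<Rightarrow> lstate" where
  "collect_echoes N t s inb = s\<lparr>
     accepted := accepted s \<union>
       {i. \<exists>l ids. inb l = Some (MULTIECHO ids) \<and> valid_echo N t s l ids \<and> i \<in> ids},
     counter := (\<lambda>i. counter s i +
       card {l. \<exists>ids. inb l = Some (MULTIECHO ids) \<and> valid_echo N t s l ids \<and> i \<in> ids})\<rparr>"

definition assign_names :: "nat \<Rightarrow> nat \<Rightarrow> lstate \<Rightarrow> lstate" where
  "assign_names N t s = s\<lparr>
     newid := (\<lambda>i. if i \<in> accepted s
                   then Some (\<Sum>j \<in> {j \<in> accepted s. j \<le> i}. min (counter s j) (N - t))
                   else None)\<rparr>"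

definition transB ::
  "nat \<Rightarrow> nat \<Rightarrow> nat \<Rightarrow> lstate \<Rightarrow> (nat \<Rightarrow> msg option) \<Rightarrow> lstate" where
  "transB N t k s inb =
     (if k = 1 then step1 s inb
      else if k = 2 then assign_names N t (collect_echoes N t s inb)
      else s)"

definition algorithm_B :: "nat \<Rightarrow> nat \<Rightarrow> (lstate, msg, nat) protocol" where
  "algorithm_B N t =
     \<lparr>init = initB, bcast = bcastB, trans = transB N t, outp = (\<lambda>s. newid s (my_id s))\<rparr>"

end

theory Submission
  imports Defs
begin

text \<open>
  Every correct identifier is echoed by every correct process, so it contributes exactly \<open>N - t\<close> to
  every name sum that includes it. Other identifiers can contribute differently at two receivers
  only through echoes of faulty processes. A valid echo has at most \<open>N\<close> elements and meets the
  timely set in at least \<open>N - t\<close>, of which at most \<open>t\<close> are not correct identifiers; hence it contains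
  at most \<open>2 * t\<close> incorrect identifiers. The name sums of two receivers up to the same identifier thus
  differ by at most \<open>2 * t\<^sup>2 < N - t\<close>, less than the contribution of the next correct identifier.
\<close>

text \<open>Double counting of the pairs \<open>(j, q)\<close> with \<open>j \<in> E q\<close>. It
  turns vote totals per identifier into echo sizes per sender, where the bounds on single echoes
  apply.\<close>

lemma sum_card_mem_swap:
  assumes "finite A" "finite Q"
  shows "(\<Sum>j\<in>A. card {q\<in>Q. j \<in> E q}) = (\<Sum>q\<in>Q. card (A \<inter> E q))"
proof -
  have "card {q\<in>Q. j \<in> E q} = (\<Sum>q\<in>Q. of_bool (j \<in> E q))" for j
    using assms by (simp add: Int_def)
  moreover have "card (A \<inter> E q) = (\<Sum>j\<in>A. of_bool (j \<in> E q))" for q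
    using assms by (simp add: Int_def)
  ultimately show ?thesis
    by (simp only: sum.swap[of _ Q A])
qed

section \<open>Executions described by senders instead of link labels\<close>

locale algorithm_B_execution = byzantine_system N t Nmax procs correct link orig
  for N t :: nat and Nmax :: int
    and procs correct :: "'p set"
    and link :: "'p \<Rightarrow> nat \<Rightarrow> 'p" and orig :: "'p \<Rightarrow> int" +
  fixes sent :: "nat \<Rightarrow> 'p \<Rightarrow> 'p \<Rightarrow> msg option"
    and st :: "'p \<Rightarrow> nat \<Rightarrow> lstate"
  assumes N_gt: "N > 2 * t^2 + t"
    and exec: "execution (algorithm_B N t) N procs correct link orig sent st"
begin

text \<open>Keeps the step number in \<open>sent 1\<close> and \<open>st p 1\<close> literal;
  rewritten to \<open>Suc 0\<close>, it would no longer match the facts about step one.\<close>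

declare One_nat_def [simp del]

definition timely_ids :: "'p \<Rightarrow> int set" where
  "timely_ids p = {i. \<exists>q\<in>procs. sent 1 q p = Some (ID i)}"

text \<open>The condition on \<open>sent 1 q p\<close> plays the role of \<open>linkid\<close> being
  set on the link from \<open>q\<close>.\<close>

definition echo_ok :: "'p \<Rightarrow> 'p \<Rightarrow> int set \<Rightarrow> bool" where
  "echo_ok p q ids \<longleftrightarrow> sent 2 q p = Some (MULTIECHO ids) \<and> (\<exists>i. sent 1 q p = Some (ID i)) \<and>
     finite ids \<and> card ids \<le> N \<and> card (timely_ids p \<inter> ids) \<ge> N - t"

text \<open>At most one set satisfies \<open>echo_ok p q\<close>; the union yields \<open>{}\<close> when there is none.\<close>

definition echo :: "'p \<Rightarrow> 'p \<Rightarrow> int set" where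
  "echo p q = \<Union>{ids. echo_ok p q ids}"

definition votes :: "'p \<Rightarrow> int \<Rightarrow> nat" where
  "votes p i = card {q\<in>procs. i \<in> echo p q}"

definition accepted_ids :: "'p \<Rightarrow> int set" where
  "accepted_ids p = (\<Union>q\<in>procs. echo p q)"

definition name :: "'p \<Rightarrow> int \<Rightarrow> nat" where
  "name p i = (\<Sum>j\<in>{j\<in>accepted_ids p. j \<le> i}. min (votes p j) (N - t))"

abbreviation correct_ids :: "int set" where
  "correct_ids \<equiv> orig ` correct"

lemma exec_init: "p \<in> correct \<Longrightarrow> st p 0 = initB (orig p)"
  and exec_sent: "p \<in> correct \<Longrightarrow> q \<in> procs \<Longrightarrow> sent (Suc k) p q = bcastB (Suc k) (st p k)"
  and exec_step: "p \<in> correct \<Longrightarrow>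
    st p (Suc k) = transB N t (Suc k) (st p k) (inbox N link sent (Suc k) p)"
  using exec by (auto simp: execution_def algorithm_B_def)

lemma mem_procs: "p \<in> correct \<Longrightarrow> p \<in> procs"
  using correct_subset by blast

lemma inbox_eq_Some:
  "inbox N link sent k p l = Some m \<longleftrightarrow> l \<in> {1..N} \<and> sent k (link p l) p = Some m"
  by (auto simp: inbox_def)

lemma link_image: "p \<in> procs \<Longrightarrow> link p ` {1..N} = procs"
  using link_bij[of p] by (simp add: bij_betw_def)

text \<open>\<open>counter\<close> counts link labels while \<open>votes\<close> counts processes;
  the bijection \<open>link p\<close> identifies the two.\<close>

lemma card_links:
  assumes "p \<in> procs"
  shows "card {l\<in>{1..N}. P (link p l)} = card {q\<in>procs. P q}"
proof -
  have "inj_on (link p) {l\<in>{1..N}. P (link p l)}"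
    by (rule inj_on_subset[OF bij_betw_imp_inj_on[OF link_bij[OF assms]]]) blast
  then have "card {l\<in>{1..N}. P (link p l)} = card (link p ` {l\<in>{1..N}. P (link p l)})"
    by (rule card_image[symmetric])
  also have "link p ` {l\<in>{1..N}. P (link p l)} = {q\<in>link p ` {1..N}. P q}"
    by blast
  finally show ?thesis
    by (simp only: link_image[OF assms])
qed

lemma state_1:
  assumes "p \<in> correct"
  shows "my_id (st p 1) = orig p" "timely (st p 1) = timely_ids p"
    "accepted (st p 1) = {}" "counter (st p 1) = (\<lambda>_. 0)"
    "l \<in> {1..N} \<Longrightarrow> linkid (st p 1) l \<noteq> None \<longleftrightarrow> (\<exists>i. sent 1 (link p l) p = Some (ID i))"
proof -
  have st: "st p 1 = step1 (initB (orig p)) (inbox N link sent 1 p)"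
    using exec_step[OF assms, of 0] exec_init[OF assms] by (simp add: transB_def One_nat_def)
  show "my_id (st p 1) = orig p" "accepted (st p 1) = {}" "counter (st p 1) = (\<lambda>_. 0)"
    by (simp_all add: st step1_def initB_def)
  show "timely (st p 1) = timely_ids p"
    unfolding st step1_def initB_def timely_ids_def
    using link_image[OF mem_procs[OF assms]] by (force simp: inbox_eq_Some)
  show "l \<in> {1..N} \<Longrightarrow> linkid (st p 1) l \<noteq> None \<longleftrightarrow> (\<exists>i. sent 1 (link p l) p = Some (ID i))"
    by (auto simp: st step1_def initB_def inbox_def split: option.splits msg.splits)
qed

text \<open>The left side is the predicate from which \<open>collect_echoes\<close> builds both
  \<open>accepted\<close> and \<open>counter\<close>, so one translation serves both fields.\<close>

lemma inbox_echo_iff: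
  assumes "p \<in> correct"
  shows "(\<exists>ids. inbox N link sent 2 p l = Some (MULTIECHO ids) \<and> valid_echo N t (st p 1) l ids
            \<and> i \<in> ids) \<longleftrightarrow> l \<in> {1..N} \<and> i \<in> echo p (link p l)"
  by (cases "l \<in> {1..N}") (auto simp: inbox_eq_Some valid_echo_def echo_def echo_ok_def
      state_1(2)[OF assms] state_1(5)[OF assms, of l] simp del: not_None_eq atLeastAtMost_iff)

text \<open>From here on the output is handled only through \<open>name\<close>.\<close>

lemma output_eq:
  assumes "p \<in> correct"
  shows "outp (algorithm_B N t) (st p 2) =
    (if orig p \<in> accepted_ids p then Some (name p (orig p)) else None)"
proof -
  let ?c = "collect_echoes N t (st p 1) (inbox N link sent 2 p)"
  have st: "st p 2 = assign_names N t ?c"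
    using exec_step[OF assms, of 1] by (simp add: transB_def Suc_1)
  have "(\<Union>q\<in>link p ` {1..N}. echo p q) = {i. \<exists>l. l \<in> {1..N} \<and> i \<in> echo p (link p l)}"
    by auto
  then have acc: "accepted ?c = accepted_ids p"
    by (simp add: collect_echoes_def state_1(3)[OF assms] inbox_echo_iff[OF assms] accepted_ids_def
        link_image[OF mem_procs[OF assms]] del: atLeastAtMost_iff)
  have cnt: "counter ?c = votes p"
  proof
    fix i
    have "counter ?c i = card {l\<in>{1..N}. i \<in> echo p (link p l)}"
      by (simp add: collect_echoes_def state_1(4)[OF assms] inbox_echo_iff[OF assms]
          del: atLeastAtMost_iff)
    then show "counter ?c i = votes p i"
      by (simp only: votes_def card_links[OF mem_procs[OF assms], of "\<lambda>q. i \<in> echo p q"])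
  qed
  have "my_id ?c = orig p"
    by (simp add: collect_echoes_def state_1(1)[OF assms])
  then show ?thesis
    by (simp add: st assign_names_def algorithm_B_def acc cnt name_def)
qed

section \<open>Timely sets and echoes\<close>

lemma card_correct_ge: "card correct \<ge> N - t"
  and card_correct_ids: "card correct_ids = card correct"
  and finite_correct: "finite correct"
proof -
  show "finite correct"
    using finite_subset[OF correct_subset finite_procs] .
  have "card correct = N - card (procs - correct)"
    using card_Diff_subset[OF \<open>finite correct\<close> correct_subset] card_mono[OF finite_procs correct_subset]
      card_procs by simp
  then show "card correct \<ge> N - t"
    using faulty_bound by simp
  show "card correct_ids = card correct"
    by (rule card_image[OF orig_unique])
qed

lemma sent_1: "q \<in> correct \<Longrightarrow> p \<in> procs \<Longrightarrow> sent 1 q p = Some (ID (orig q))"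
  using exec_sent[of q p 0] exec_init[of q] by (simp add: bcastB_def initB_def One_nat_def)

lemma sent_2: "q \<in> correct \<Longrightarrow> p \<in> procs \<Longrightarrow> sent 2 q p = Some (MULTIECHO (timely_ids q))"
  using exec_sent[of q p 1] state_1(2)[of q] by (simp add: bcastB_def Suc_1)

lemma correct_ids_subset_timely: "p \<in> procs \<Longrightarrow> correct_ids \<subseteq> timely_ids p"
  by (auto simp: timely_ids_def intro!: bexI sent_1 mem_procs)

lemma finite_timely: "finite (timely_ids p)"
  and card_timely_le: "card (timely_ids p) \<le> N"
proof -
  \<comment> \<open>Each process delivers at most one identifier to \<open>p\<close>. The default 0
    for the others can only enlarge the image, which still has at most \<open>N\<close>
    elements.\<close>
  have sub: "timely_ids p \<subseteq> (\<lambda>q. case sent 1 q p of Some (ID i) \<Rightarrow> i | _ \<Rightarrow> 0) ` procs"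
    by (force simp: timely_ids_def)
  show "finite (timely_ids p)"
    using finite_subset[OF sub] finite_procs by simp
  show "card (timely_ids p) \<le> N"
    using surj_card_le[OF finite_procs sub] card_procs by simp
qed

text \<open>Both timely sets contain all correct identifiers, at least \<open>N - t\<close> many, so
  the overlap test of the receiver always succeeds.\<close>

lemma echo_correct:
  assumes "q \<in> correct" "p \<in> correct"
  shows "echo p q = timely_ids q"
proof -
  have "card correct_ids \<le> card (timely_ids p \<inter> timely_ids q)"
    using correct_ids_subset_timely mem_procs assms finite_timely by (intro card_mono) auto
  then have "N - t \<le> card (timely_ids p \<inter> timely_ids q)"
    using card_correct_ge card_correct_ids by simp
  then show ?thesis
    using sent_1[of q p] sent_2[of q p] finite_timely card_timely_le assms mem_procs
    by (auto simp: echo_def echo_ok_def)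
qed

lemma echo_cases: "echo p q = {} \<or> echo_ok p q (echo p q)"
proof (cases "\<exists>ids. echo_ok p q ids")
  case True
  then obtain ids where ids: "echo_ok p q ids" by blast
  then have "{ids. echo_ok p q ids} = {ids}"
    by (auto simp: echo_ok_def)
  with ids show ?thesis by (simp add: echo_def)
qed (simp add: echo_def)

lemma finite_echo: "finite (echo p q)"
  and card_echo_le: "card (echo p q) \<le> N"
  using echo_cases[of p q] by (auto simp: echo_ok_def)

lemma card_fake_echo_le:
  assumes "p \<in> procs"
  shows "card (echo p q - correct_ids) \<le> 2 * t"
proof (cases "echo p q = {}")
  case False
  let ?E = "echo p q"
  have E: "N - t \<le> card (timely_ids p \<inter> ?E)"
    using False echo_cases[of p q] by (auto simp: echo_ok_def)
  have fin: "finite correct_ids"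
    using finite_correct by simp
  \<comment> \<open>The overlap is split by correctness: its incorrect part lies in
    \<open>timely_ids p\<close>, which has at most \<open>t\<close> incorrect elements; the rest are
    correct entries of the echo.\<close>
  have "card (timely_ids p \<inter> ?E) \<le> card ((timely_ids p - correct_ids) \<union> (?E \<inter> correct_ids))"
    using finite_timely finite_echo by (intro card_mono) auto
  also have "\<dots> \<le> card (timely_ids p - correct_ids) + card (?E \<inter> correct_ids)"
    by (rule card_Un_le)
  also have "card (timely_ids p - correct_ids) = card (timely_ids p) - card correct_ids"
    by (rule card_Diff_subset[OF fin correct_ids_subset_timely[OF assms]])
  also have "\<dots> \<le> t"
    using card_timely_le[of p] card_correct_ids card_correct_ge by simp
  finally have "N - 2 * t \<le> card (?E \<inter> correct_ids)"
    using E by simp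
  moreover have "card (?E - correct_ids) + card (?E \<inter> correct_ids) = card ?E"
    using card_Int_Diff[OF finite_echo[of p q], of correct_ids] by simp
  ultimately show ?thesis
    using card_echo_le[of p q] by linarith
qed simp

section \<open>Votes and accepted identifiers\<close>

lemma finite_accepted: "finite (accepted_ids p)"
  using finite_procs finite_echo by (auto simp: accepted_ids_def)

lemma votes_eq_0: "i \<notin> accepted_ids p \<Longrightarrow> votes p i = 0"
  unfolding votes_def accepted_ids_def by (subst card_eq_0_iff) blast

text \<open>The first summand does not depend on the receiver \<open>p\<close>; two correct
  receivers can disagree only through the second.\<close>

lemma votes_split:
  assumes "p \<in> correct"
  shows "votes p i = card {r\<in>correct. i \<in> timely_ids r} + card {r\<in>procs - correct. i \<in> echo p r}"
proof -
  have "{q\<in>procs. i \<in> echo p q} =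
      {r\<in>correct. i \<in> timely_ids r} \<union> {r\<in>procs - correct. i \<in> echo p r}"
    using echo_correct[OF _ assms] mem_procs by auto
  moreover have "card ({r\<in>correct. i \<in> timely_ids r} \<union> {r\<in>procs - correct. i \<in> echo p r}) =
      card {r\<in>correct. i \<in> timely_ids r} + card {r\<in>procs - correct. i \<in> echo p r}"
    using finite_correct finite_procs by (intro card_Un_disjoint) auto
  ultimately show ?thesis
    by (simp only: votes_def)
qed

text \<open>All correct processes vote for a correct identifier, so the cap is reached whatever the
  faulty ones add.\<close>

lemma min_votes_correct_id:
  assumes "p \<in> correct" "i \<in> correct_ids"
  shows "min (votes p i) (N - t) = N - t"
proof -
  have "{r\<in>correct. i \<in> timely_ids r} = correct"
    using correct_ids_subset_timely mem_procs assms(2) by blast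
  then show ?thesis
    using votes_split[OF assms(1), of i] card_correct_ge by simp
qed

lemma correct_ids_subset_accepted:
  assumes "p \<in> correct"
  shows "correct_ids \<subseteq> accepted_ids p"
proof -
  \<comment> \<open>The echo that \<open>p\<close> sends to itself serves as the witness.\<close>
  have "correct_ids \<subseteq> echo p p"
    using correct_ids_subset_timely[OF mem_procs] echo_correct assms by simp
  also have "\<dots> \<subseteq> accepted_ids p"
    unfolding accepted_ids_def using mem_procs[OF assms] by (rule UN_upper)
  finally show ?thesis .
qed

lemma min_votes_le:
  assumes "p \<in> correct" "q \<in> correct"
  shows "min (votes p i) (N - t) \<le> min (votes q i) (N - t) +
    (if i \<in> correct_ids then 0 else card {r\<in>procs - correct. i \<in> echo p r})"
proof (cases "i \<in> correct_ids")
  case True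
  then show ?thesis
    using min_votes_correct_id assms by simp
next
  case False
  then show ?thesis
    unfolding votes_split[OF assms(1)] votes_split[OF assms(2)] by simp
qed

section \<open>Comparison of names across receivers\<close>

text \<open>Identifiers that are not accepted have no votes, so adding them changes nothing. This
  puts the names at two receivers over a common index set.\<close>

lemma name_eq_sum_superset:
  assumes "accepted_ids p \<subseteq> U" "finite U"
  shows "name p i = (\<Sum>j\<in>{j\<in>U. j \<le> i}. min (votes p j) (N - t))"
  unfolding name_def
proof (rule sum.mono_neutral_left)
  show "\<forall>j\<in>{j\<in>U. j \<le> i} - {j\<in>accepted_ids p. j \<le> i}. min (votes p j) (N - t) = 0"
    using votes_eq_0[of _ p] by (metis (mono_tags, lifting) Diff_iff mem_Collect_eq min_0L)
qed (use assms in auto)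

lemma name_le_name:
  assumes "p \<in> correct" "q \<in> correct"
  shows "name p i \<le> name q i + 2 * t^2"
proof -
  define U where "U = {j \<in> accepted_ids p \<union> accepted_ids q. j \<le> i}"
  let ?F = "procs - correct"
  have fin: "finite U"
    using finite_accepted by (simp add: U_def)
  have "(\<Sum>j\<in>U. if j \<in> correct_ids then 0 else card {r\<in>?F. j \<in> echo p r}) =
      (\<Sum>j\<in>U - correct_ids. card {r\<in>?F. j \<in> echo p r})"
    using fin by (intro sum.mono_neutral_cong_right) auto
  \<comment> \<open>Regrouping by faulty sender: there are at most \<open>t\<close> of them, each
    supporting at most \<open>2 * t\<close> incorrect identifiers.\<close>
  also have "\<dots> = (\<Sum>r\<in>?F. card ((U - correct_ids) \<inter> echo p r))"
    using fin finite_procs by (intro sum_card_mem_swap) auto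
  also have "\<dots> \<le> (\<Sum>r\<in>?F. 2 * t)"
  proof (rule sum_mono)
    fix r
    have "card ((U - correct_ids) \<inter> echo p r) \<le> card (echo p r - correct_ids)"
      using finite_echo by (intro card_mono) auto
    then show "card ((U - correct_ids) \<inter> echo p r) \<le> 2 * t"
      using card_fake_echo_le[OF mem_procs[OF assms(1)], of r] by simp
  qed
  also have "\<dots> \<le> 2 * t^2"
    using faulty_bound by (simp add: power2_eq_square)
  finally have excess: "(\<Sum>j\<in>U. if j \<in> correct_ids then 0 else card {r\<in>?F. j \<in> echo p r}) \<le> 2 * t^2" .
  have "name p i = (\<Sum>j\<in>U. min (votes p j) (N - t))"
    unfolding U_def using finite_accepted by (intro name_eq_sum_superset) auto
  also have "\<dots> \<le> (\<Sum>j\<in>U. min (votes q j) (N - t) +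
      (if j \<in> correct_ids then 0 else card {r\<in>?F. j \<in> echo p r}))"
    using min_votes_le[OF assms] by (rule sum_mono)
  also have "\<dots> = name q i + (\<Sum>j\<in>U. if j \<in> correct_ids then 0 else card {r\<in>?F. j \<in> echo p r})"
    using name_eq_sum_superset[of q "accepted_ids p \<union> accepted_ids q" i] finite_accepted
    by (simp add: sum.distrib U_def)
  finally show ?thesis
    using excess by simp
qed

text \<open>\<open>i'\<close> is itself a summand absent from \<open>name q i\<close>, and being
  correct it contributes the full \<open>N - t\<close>. Nothing is required of
  \<open>i\<close>.\<close>

lemma name_less_gap:
  assumes "q \<in> correct" "i < i'" "i' \<in> correct_ids"
  shows "name q i + (N - t) \<le> name q i'"
proof -
  have "i' \<in> accepted_ids q"
    using correct_ids_subset_accepted assms by blast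
  then have "(\<Sum>j\<in>insert i' {j\<in>accepted_ids q. j \<le> i}. min (votes q j) (N - t)) \<le> name q i'"
    unfolding name_def using finite_accepted assms(2) by (intro sum_mono2) auto
  then show ?thesis
    using finite_accepted[of q] assms(2) min_votes_correct_id[OF assms(1,3)]
    by (simp add: name_def)
qed

text \<open>Without the cap, the sum counts pairs of a sender and an entry of its echo: at most
  \<open>N\<close> senders with at most \<open>N\<close> entries each.\<close>

lemma name_le_square: "name p i \<le> N^2"
proof -
  have "name p i \<le> (\<Sum>j\<in>{j\<in>accepted_ids p. j \<le> i}. votes p j)"
    unfolding name_def by (rule sum_mono) simp
  also have "\<dots> = (\<Sum>q\<in>procs. card ({j\<in>accepted_ids p. j \<le> i} \<inter> echo p q))"
    unfolding votes_def using finite_accepted finite_procs by (intro sum_card_mem_swap) auto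
  also have "\<dots> \<le> (\<Sum>q\<in>procs. N)"
  proof (rule sum_mono)
    fix q
    have "card ({j\<in>accepted_ids p. j \<le> i} \<inter> echo p q) \<le> card (echo p q)"
      using finite_echo by (intro card_mono) auto
    then show "card ({j\<in>accepted_ids p. j \<le> i} \<inter> echo p q) \<le> N"
      using card_echo_le[of p q] by simp
  qed
  finally show ?thesis
    using card_procs by (simp add: power2_eq_square)
qed

lemma name_pos:
  assumes "p \<in> correct" "i \<in> correct_ids"
  shows "name p i \<ge> 1"
  \<comment> \<open>With \<open>i - 1\<close> as the smaller identifier the gap alone is a lower
    bound, and \<open>N_gt\<close> makes \<open>N - t\<close> positive.\<close>
  using name_less_gap[OF assms(1), of "i - 1" i] assms(2) N_gt by simp

text \<open>The chain is \<open>name p (orig p) \<le> name q (orig p) + 2 * t^2 < name q (orig p) +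
  (N - t) \<le> name q (orig q)\<close>, with \<open>N_gt\<close> giving the strict step.\<close>

lemma name_strict_mono:
  assumes "p \<in> correct" "q \<in> correct" "orig p < orig q"
  shows "name p (orig p) < name q (orig q)"
  using name_le_name[OF assms(1,2), of "orig p"] name_less_gap[OF assms(2,3)] assms(2) N_gt
  by simp

theorem order_preserving_renaming_algorithm_B:
  "order_preserving_renaming (N^2) correct orig (\<lambda>p. outp (algorithm_B N t) (st p 2))"
  unfolding order_preserving_renaming_def
proof (intro exI[of _ "\<lambda>p. name p (orig p)"] conjI ballI impI)
  fix p assume p: "p \<in> correct"
  \<comment> \<open>A correct process accepts its own identifier, which rules out the output
    \<open>None\<close>.\<close>
  show "outp (algorithm_B N t) (st p 2) = Some (name p (orig p))"
    using output_eq[OF p] correct_ids_subset_accepted[OF p] p by (simp add: image_subset_iff)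
  show "name p (orig p) \<in> {1..N^2}"
    using name_pos name_le_square p by simp
qed (rule name_strict_mono)

end

theorem theorem3:
  fixes N t :: nat and Nmax :: int
    and procs correct :: "'p set"
    and link :: "'p \<Rightarrow> nat \<Rightarrow> 'p" and orig :: "'p \<Rightarrow> int"
    and sent :: "nat \<Rightarrow> 'p \<Rightarrow> 'p \<Rightarrow> msg option"
    and st :: "'p \<Rightarrow> nat \<Rightarrow> lstate"
  assumes "byzantine_system N t Nmax procs correct link orig"
    and "N > 2 * t^2 + t"
    and "execution (algorithm_B N t) N procs correct link orig sent st"
  shows "order_preserving_renaming (N^2) correct orig
           (\<lambda>p. outp (algorithm_B N t) (st p 2))"
proof -
  interpret byzantine_system N t Nmax procs correct link orig
    by (rule assms(1))
  interpret algorithm_B_execution N t Nmax procs correct link orig sent st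
    using assms(2,3) by unfold_locales
  show ?thesis
    by (rule order_preserving_renaming_algorithm_B)
qed

end
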